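(* For $x\in V$ let $$\theta(x)=\Big\langle\sum_{l=0}^{\tau_B}\mathbf 1_x(x_l)\Big\rangle,\quad \bar\theta(x)=\Big\langle\sum_{l=0}^{\sigma}\mathbf 1_x(x_l)\Big\rangle,\quad \widetilde\theta(x)=\Big\langle\sum_{l=\sigma}^{\tau_B}\mathbf 1_x(x_l)\Big\rangle,$$ and $\mu_r(x)=\langle\mathbf 1_x(x_\sigma)\rangle$ for $x\in A$. Then for any $x\in V$, $$\bar\theta(x)=\theta(x)\,(1-q(x)),\qquad \widetilde\theta(x)=\theta(x)\,q(x)+\mu_r(x)\mathbf 1_A(x).$$
   Context: $V=\{1,\dots,n\}$ with $n>1$; $p(y\,|\,x)$, $x,y\in V$, is the probability that a discrete-time Markov chain $(x_k)_{k\ge0}$ on $V$ jumps from $x$ to $y$ (so $\sum_{y}p(y\,|\,x)=1$). $A,B\subset V$ are disjoint and nonempty, complements are taken in $V$, and $\mu$ is a probability distribution on $A$. For $x\in V$, a set $A$ (resp. $B$) is reachable from $x$ if there is a finite path $x_0=x,x_1,\dots,x_k$, $k\ge0$, with $x_k\in A$ (resp. $x_k\in B$), $x_l\in(A\cup B)^c$ for $1\le l\le k-1$, and $p(x_{l+1}\,|\,x_l)>0$ for $0\le l\le k-1$. Standing assumption: $(A\cup B)^c\ne\emptyset$; from each $x\in(A\cup B)^c$ either $A$ or $B$ is reachable; and $B$ is reachable from each $x\in A$. $\tau_A=\min\{k\ge0:x_k\in A\}$, $\tau_B=\min\{k\ge 0:x_k\in B\}$ ($+\infty$ if never reached), with subscript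 $x$ when $x_0=x$. Committor: $q(x)=\mathbb P(\tau_{B,x}<\tau_{A,x})$, $x\in V$. For $x_0\in A$, the last hitting time of $A$ is $\sigma=\max\{l: x_l\in A,\ 0\le l<\tau_B\}$. $\langle\cdot\rangle$ denotes expectation over first passage paths $(x_0,\dots,x_{\tau_B})$ of the chain with $x_0\sim\mu$; $\mathbf 1_x$ is the indicator of $\{x\}$. The term $\mu_r(x)\mathbf 1_A(x)$ is $0$ for $x\notin A$. *)

theory Defs
  imports "HOL-Probability.Probability"
begin

text \<open>
  The transition probability p(y|x) is \<open>pmf (p x) y\<close>. The Markov property is stated in product
  form, so that conditioning on null events does not arise. The chain takes its values in \<open>V\<close>
  everywhere, by measurability into \<open>count_space V\<close>.
\<close>

locale markov_chain = prob_space M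
  for V :: "'s set" and p :: "'s \<Rightarrow> 's pmf" and \<nu> :: "'s pmf"
    and M :: "'w measure" and X :: "nat \<Rightarrow> 'w \<Rightarrow> 's" +
  assumes state_measurable: "\<And>k. X k \<in> M \<rightarrow>\<^sub>M count_space V"
    and initial: "\<And>x. x \<in> V \<Longrightarrow> \<P>(w in M. X 0 w = x) = pmf \<nu> x"
    and markov: "\<And>k z y. \<lbrakk>\<And>i. i \<le> k \<Longrightarrow> z i \<in> V; y \<in> V\<rbrakk> \<Longrightarrow>
      \<P>(w in M. (\<forall>i\<le>k. X i w = z i) \<and> X (Suc k) w = y)
        = \<P>(w in M. \<forall>i\<le>k. X i w = z i) * pmf (p (z k)) y"

text \<open>\<open>S\<close> is reachable from \<open>x\<close> along a path whose interior avoids \<open>A \<union> B\<close>.\<close>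

definition reachable ::
  "'s set \<Rightarrow> ('s \<Rightarrow> 's pmf) \<Rightarrow> 's set \<Rightarrow> 's set \<Rightarrow> 's set \<Rightarrow> 's \<Rightarrow> bool" where
  "reachable V p A B S x \<longleftrightarrow>
     (\<exists>k z. z 0 = x \<and> (\<forall>l\<le>k. z l \<in> V) \<and> z k \<in> S
        \<and> (\<forall>l. 1 \<le> l \<and> l < k \<longrightarrow> z l \<in> V - (A \<union> B))
        \<and> (\<forall>l<k. pmf (p (z l)) (z (Suc l)) > 0))"

text \<open>The infimum of the empty set in \<^typ>\<open>enat\<close> is \<open>\<infinity>\<close>.\<close>

definition hitting_time :: "'s set \<Rightarrow> (nat \<Rightarrow> 's) \<Rightarrow> enat" where
  "hitting_time S z = (INF k\<in>{k. z k \<in> S}. enat k)"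

text \<open>
  The set is nonempty and finite when the path starts in \<open>A\<close> and reaches \<open>B\<close>. If \<open>B\<close> is
  reachable from every state of \<open>A\<close>, and \<open>A\<close> or \<open>B\<close> from every state outside \<open>A \<union> B\<close>,
  a chain on a finite \<open>V\<close> started in \<open>A\<close> reaches \<open>B\<close> almost surely, so the remaining
  paths do not affect expectations.
\<close>

definition last_hit :: "'s set \<Rightarrow> 's set \<Rightarrow> (nat \<Rightarrow> 's) \<Rightarrow> nat" where
  "last_hit A B z = Max {l. z l \<in> A \<and> enat l < hitting_time B z}"

definition visits :: "enat \<Rightarrow> enat \<Rightarrow> 's \<Rightarrow> (nat \<Rightarrow> 's) \<Rightarrow> ennreal" where
  "visits s t x z = (\<Sum>l. if s \<le> enat l \<and> enat l \<le> t then indicator {x} (z l) else 0)"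

text \<open>In the following, the sample path at \<open>w\<close> is \<open>\<lambda>k. X k w\<close>.\<close>

definition committor ::
  "'w measure \<Rightarrow> (nat \<Rightarrow> 'w \<Rightarrow> 's) \<Rightarrow> 's set \<Rightarrow> 's set \<Rightarrow> real" where
  "committor M X A B =
     \<P>(w in M. hitting_time B (\<lambda>k. X k w) < hitting_time A (\<lambda>k. X k w))"

definition theta ::
  "'w measure \<Rightarrow> (nat \<Rightarrow> 'w \<Rightarrow> 's) \<Rightarrow> 's set \<Rightarrow> 's \<Rightarrow> ennreal" where
  "theta M X B x =
     (\<integral>\<^sup>+ w. visits 0 (hitting_time B (\<lambda>k. X k w)) x (\<lambda>k. X k w) \<partial>M)"

definition theta_bar ::
  "'w measure \<Rightarrow> (nat \<Rightarrow> 'w \<Rightarrow> 's) \<Rightarrow> 's set \<Rightarrow> 's set \<Rightarrow> 's \<Rightarrow> ennreal" where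
  "theta_bar M X A B x =
     (\<integral>\<^sup>+ w. visits 0 (enat (last_hit A B (\<lambda>k. X k w))) x (\<lambda>k. X k w) \<partial>M)"

definition theta_tilde ::
  "'w measure \<Rightarrow> (nat \<Rightarrow> 'w \<Rightarrow> 's) \<Rightarrow> 's set \<Rightarrow> 's set \<Rightarrow> 's \<Rightarrow> ennreal" where
  "theta_tilde M X A B x =
     (\<integral>\<^sup>+ w. visits (enat (last_hit A B (\<lambda>k. X k w))) (hitting_time B (\<lambda>k. X k w)) x
              (\<lambda>k. X k w) \<partial>M)"

definition mu_r ::
  "'w measure \<Rightarrow> (nat \<Rightarrow> 'w \<Rightarrow> 's) \<Rightarrow> 's set \<Rightarrow> 's set \<Rightarrow> 's \<Rightarrow> ennreal" where
  "mu_r M X A B x =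
     (\<integral>\<^sup>+ w. indicator {x} (X (last_hit A B (\<lambda>k. X k w)) w) \<partial>M)"

end

theory Submission
  imports Defs
begin

text \<open>
  Before \<open>\<tau>\<^sub>B\<close>, time \<open>l\<close> lies at or before \<open>\<sigma>\<close> iff the path from time \<open>l\<close> onwards meets \<open>A\<close> before
  \<open>B\<close>, and strictly after \<open>\<sigma>\<close> iff it meets \<open>B\<close> first. The event \<open>x\<^sub>l = x, l \<le> \<tau>\<^sub>B\<close> depends on the
  history up to time \<open>l\<close> only, so the Markov property splits off the factors \<open>1 - q x\<close> and \<open>q x\<close>
  from each term of \<open>\<theta> x\<close>. The time \<open>\<sigma>\<close> itself contributes \<open>\<mu>\<^sub>r\<close>. That \<open>B\<close>, and \<open>A \<union> B\<close>, is reached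
  almost surely follows from the maximum principle for the limiting survival probability.
\<close>

section \<open>Events of the past and first entries\<close>

text \<open>Stands in for membership in the natural filtration at time \<open>k\<close>: with
  finitely many states, an event of the past is then a finite union of cylinders.\<close>

definition history :: "nat \<Rightarrow> ((nat \<Rightarrow> 's) \<Rightarrow> bool) \<Rightarrow> bool" where
  "history k Q \<longleftrightarrow> (\<forall>z z'. (\<forall>i\<le>k. z i = z' i) \<longrightarrow> Q z = Q z')"

text \<open>If \<open>C\<close> and \<open>S\<close> are disjoint, \<open>m\<close> is unique: it is
  the time of the first exit from \<open>C\<close>. With \<open>C = V - (A \<union> B)\<close>,
  taking \<open>S\<close> to be \<open>A\<close> or \<open>B\<close> tells which of the two sets is
  met first.\<close>

definition enters :: "'s set \<Rightarrow> 's set \<Rightarrow> (nat \<Rightarrow> 's) \<Rightarrow> bool" where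
  "enters C S z \<longleftrightarrow> (\<exists>m. (\<forall>i<m. z i \<in> C) \<and> z m \<in> S)"

text \<open>The probability, from \<open>x\<close>, to be in \<open>C\<close> at times \<open>0, \<dots>, m - 1\<close> and in \<open>S\<close> at time \<open>m\<close>.\<close>

fun entry_prob :: "('s \<Rightarrow> 's pmf) \<Rightarrow> 's set \<Rightarrow> 's set \<Rightarrow> 's set \<Rightarrow> nat \<Rightarrow> 's \<Rightarrow> real" where
  "entry_prob p V C S 0 x = indicator S x"
| "entry_prob p V C S (Suc m) x = indicator C x * (\<Sum>y\<in>V. pmf (p x) y * entry_prob p V C S m y)"

section \<open>The Markov property for events of the past\<close>

locale finite_markov_chain = markov_chain V p \<nu> M X
  for V :: "'s set" and p :: "'s \<Rightarrow> 's pmf" and \<nu> :: "'s pmf"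
    and M :: "'w measure" and X :: "nat \<Rightarrow> 'w \<Rightarrow> 's" +
  assumes finite_V: "finite V"
begin

lemma state_in: "w \<in> space M \<Longrightarrow> X k w \<in> V"
  using measurable_space[OF state_measurable] by force

lemma pred_state [measurable]: "Measurable.pred M (\<lambda>w. X k w \<in> S)"
proof -
  have "{w \<in> space M. X k w \<in> S} = X k -` (S \<inter> V) \<inter> space M"
    using state_in by auto
  also have "\<dots> \<in> sets M"
    by (rule measurable_sets[OF state_measurable]) auto
  finally show ?thesis by simp
qed

lemma pred_state_eq [measurable]: "Measurable.pred M (\<lambda>w. X k w = x)"
  using pred_state[of k "{x}"] by simp

lemma pred_enters [measurable]: "Measurable.pred M (\<lambda>w. enters C S (\<lambda>i. X (k + i) w))"
  unfolding enters_def by measurable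

context
  fixes k :: nat and Q :: "(nat \<Rightarrow> 's) \<Rightarrow> bool"
  assumes Q: "history k Q"
begin

text \<open>Reduces an event of the past to cylinders, the events in the assumed Markov property.
  \<open>R\<close> is a further condition carried along, later one on the next state.\<close>

lemma history_decomp:
  "{w \<in> space M. Q (\<lambda>i. X i w) \<and> R w}
    = (\<Union>z\<in>{z \<in> {..k} \<rightarrow>\<^sub>E V. Q z}. {w \<in> space M. (\<forall>i\<le>k. X i w = z i) \<and> R w})"
proof (intro equalityI subsetI)
  fix w assume w: "w \<in> {w \<in> space M. Q (\<lambda>i. X i w) \<and> R w}"
  \<comment> \<open>Cutting the path off after time \<open>k\<close> gives an element of the finite
    index set; \<open>Q\<close> does not see the change.\<close>
  let ?z = "restrict (\<lambda>i. X i w) {..k}"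
  have "Q ?z = Q (\<lambda>i. X i w)"
    using Q[unfolded history_def, rule_format, of ?z "\<lambda>i. X i w"] by simp
  moreover have "?z \<in> {..k} \<rightarrow>\<^sub>E V"
    using w state_in by auto
  ultimately show "w \<in> (\<Union>z\<in>{z \<in> {..k} \<rightarrow>\<^sub>E V. Q z}. {w \<in> space M. (\<forall>i\<le>k. X i w = z i) \<and> R w})"
    using w by (intro UN_I[of ?z]) auto
next
  fix w assume "w \<in> (\<Union>z\<in>{z \<in> {..k} \<rightarrow>\<^sub>E V. Q z}. {w \<in> space M. (\<forall>i\<le>k. X i w = z i) \<and> R w})"
  then obtain z where z: "Q z" "w \<in> space M" "\<forall>i\<le>k. X i w = z i" "R w" by auto
  then have "Q (\<lambda>i. X i w)"
    using Q[unfolded history_def, rule_format, of "\<lambda>i. X i w" z] by simp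
  then show "w \<in> {w \<in> space M. Q (\<lambda>i. X i w) \<and> R w}" using z by simp
qed

lemma finite_histories: "finite {z \<in> {..k} \<rightarrow>\<^sub>E V. Q z}"
  by (rule finite_subset[of _ "{..k} \<rightarrow>\<^sub>E V"]) (auto intro: finite_PiE finite_V)

lemma pred_history [measurable]: "Measurable.pred M (\<lambda>w. Q (\<lambda>i. X i w))"
proof -
  have "(\<Union>z\<in>{z \<in> {..k} \<rightarrow>\<^sub>E V. Q z}. {w \<in> space M. (\<forall>i\<le>k. X i w = z i) \<and> True}) \<in> sets M"
    by (intro sets.finite_UN finite_histories) measurable
  then show ?thesis
    using history_decomp[of "\<lambda>_. True"] by (simp add: pred_def)
qed

text \<open>Finite additivity: two different extensional histories disagree at some time up to
  \<open>k\<close>, so their cylinders are disjoint.\<close>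

lemma prob_history_decomp:
  assumes [measurable]: "Measurable.pred M R"
  shows "\<P>(w in M. Q (\<lambda>i. X i w) \<and> R w)
    = (\<Sum>z\<in>{z \<in> {..k} \<rightarrow>\<^sub>E V. Q z}. \<P>(w in M. (\<forall>i\<le>k. X i w = z i) \<and> R w))"
  unfolding history_decomp
proof (rule finite_measure_finite_Union[OF finite_histories])
  show "disjoint_family_on (\<lambda>z. {w \<in> space M. (\<forall>i\<le>k. X i w = z i) \<and> R w})
      {z \<in> {..k} \<rightarrow>\<^sub>E V. Q z}"
    unfolding disjoint_family_on_def
  proof (intro ballI impI)
    fix z z' assume z: "z \<in> {z \<in> {..k} \<rightarrow>\<^sub>E V. Q z}" "z' \<in> {z \<in> {..k} \<rightarrow>\<^sub>E V. Q z}" "z \<noteq> z'"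
    then obtain i where "i \<le> k" "z i \<noteq> z' i"
      using PiE_ext[of z "{..k}" "\<lambda>_. V" z'] by auto
    then show "{w \<in> space M. (\<forall>i\<le>k. X i w = z i) \<and> R w} \<inter>
        {w \<in> space M. (\<forall>i\<le>k. X i w = z' i) \<and> R w} = {}"
      by auto
  qed
qed auto

end

text \<open>All cylinders that make up the event end in \<open>x\<close>, so the Markov property
  gives each of them the same factor \<open>pmf (p x) y\<close>, which leaves the sum.\<close>

lemma markov_history:
  assumes "history k Q" and y: "y \<in> V"
  shows "\<P>(w in M. (Q (\<lambda>i. X i w) \<and> X k w = x) \<and> X (Suc k) w = y)
    = \<P>(w in M. Q (\<lambda>i. X i w) \<and> X k w = x) * pmf (p x) y"
proof -
  have h: "history k (\<lambda>z. Q z \<and> z k = x)"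
    unfolding history_def
  proof (intro allI impI)
    fix z z' :: "nat \<Rightarrow> 's" assume z: "\<forall>i\<le>k. z i = z' i"
    show "(Q z \<and> z k = x) = (Q z' \<and> z' k = x)"
      using assms(1)[unfolded history_def, rule_format, of z z'] z by simp
  qed
  have "\<P>(w in M. (Q (\<lambda>i. X i w) \<and> X k w = x) \<and> X (Suc k) w = y)
      = (\<Sum>z\<in>{z \<in> {..k} \<rightarrow>\<^sub>E V. Q z \<and> z k = x}.
          \<P>(w in M. (\<forall>i\<le>k. X i w = z i) \<and> X (Suc k) w = y))"
    by (rule prob_history_decomp[OF h]) simp
  also have "\<dots> = (\<Sum>z\<in>{z \<in> {..k} \<rightarrow>\<^sub>E V. Q z \<and> z k = x}.
          \<P>(w in M. (\<forall>i\<le>k. X i w = z i)) * pmf (p x) y)"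
    by (intro sum.cong refl, subst markov) (use y in auto)
  also have "\<dots> = \<P>(w in M. (Q (\<lambda>i. X i w) \<and> X k w = x) \<and> True) * pmf (p x) y"
    by (subst prob_history_decomp[OF h]) (simp_all add: sum_distrib_right)
  finally show ?thesis by simp
qed

text \<open>Induction on \<open>m\<close>, with \<open>k\<close> and \<open>Q\<close> general:
  conditioning on the next state turns the present into part of the history at time
  \<open>Suc k\<close>, and the recursion of \<open>entry_prob\<close> is this one-step
  decomposition.\<close>

lemma prob_entry_at:
  assumes "history k Q" and x: "x \<in> V"
  shows "\<P>(w in M. (Q (\<lambda>i. X i w) \<and> X k w = x) \<and> (\<forall>i<m. X (k + i) w \<in> C) \<and> X (k + m) w \<in> S)
    = \<P>(w in M. Q (\<lambda>i. X i w) \<and> X k w = x) * entry_prob p V C S m x"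
  using assms
proof (induction m arbitrary: k Q x)
  case 0
  show ?case
  proof (cases "x \<in> S")
    case True
    then have "{w \<in> space M. (Q (\<lambda>i. X i w) \<and> X k w = x) \<and> (\<forall>i<0. X (k + i) w \<in> C) \<and> X (k + 0) w \<in> S}
        = {w \<in> space M. Q (\<lambda>i. X i w) \<and> X k w = x}" by auto
    then show ?thesis using True by simp
  next
    case False
    then have "{w \<in> space M. (Q (\<lambda>i. X i w) \<and> X k w = x) \<and> (\<forall>i<0. X (k + i) w \<in> C) \<and> X (k + 0) w \<in> S}
        = {}" by auto
    then show ?thesis using False by (simp only:) simp
  qed
next
  case (Suc m)
  \<comment> \<open>The state at time \<open>Suc k\<close> is fixed to be \<open>y\<close>. The
    condition \<open>x \<in> C\<close> is moved into the history, which brings the event into the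
    form of the induction hypothesis.\<close>
  let ?E = "\<lambda>y w. ((Q (\<lambda>i. X i w) \<and> X k w = x \<and> x \<in> C) \<and> X (Suc k) w = y)
      \<and> (\<forall>i<m. X (Suc k + i) w \<in> C) \<and> X (Suc k + m) w \<in> S"
  note [measurable] = pred_history[OF Suc.prems(1)]
  have h: "history (Suc k) (\<lambda>z. Q z \<and> z k = x \<and> x \<in> C)"
    unfolding history_def
  proof (intro allI impI)
    fix z z' :: "nat \<Rightarrow> 's" assume z: "\<forall>i\<le>Suc k. z i = z' i"
    show "(Q z \<and> z k = x \<and> x \<in> C) = (Q z' \<and> z' k = x \<and> x \<in> C)"
      using Suc.prems(1)[unfolded history_def, rule_format, of z z'] z by simp
  qed
  have split: "(\<forall>i<Suc m. X (k + i) w \<in> C) \<longleftrightarrow> X k w \<in> C \<and> (\<forall>i<m. X (Suc k + i) w \<in> C)" for w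
    by (simp add: All_less_Suc2)
  have "{w \<in> space M. (Q (\<lambda>i. X i w) \<and> X k w = x) \<and> (\<forall>i<Suc m. X (k + i) w \<in> C)
          \<and> X (k + Suc m) w \<in> S}
      = (\<Union>y\<in>V. {w \<in> space M. ?E y w})"
    unfolding split using state_in by auto
  then have "\<P>(w in M. (Q (\<lambda>i. X i w) \<and> X k w = x) \<and> (\<forall>i<Suc m. X (k + i) w \<in> C)
          \<and> X (k + Suc m) w \<in> S)
      = measure M (\<Union>y\<in>V. {w \<in> space M. ?E y w})"
    by (rule arg_cong)
  also have "\<dots> = (\<Sum>y\<in>V. \<P>(w in M. ?E y w))"
    by (rule finite_measure_finite_Union[OF finite_V])
      (auto simp: disjoint_family_on_def)
  also have "\<dots> = (\<Sum>y\<in>V. \<P>(w in M. (Q (\<lambda>i. X i w) \<and> X k w = x \<and> x \<in> C) \<and> X (Suc k) w = y)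
      * entry_prob p V C S m y)"
    by (intro sum.cong refl Suc.IH[OF h])
  also have "\<dots> = (\<Sum>y\<in>V. indicator C x * \<P>(w in M. (Q (\<lambda>i. X i w) \<and> X k w = x) \<and> X (Suc k) w = y)
      * entry_prob p V C S m y)"
    by (intro sum.cong refl) (auto simp: indicator_def)
  also have "\<dots> = (\<Sum>y\<in>V. indicator C x * (\<P>(w in M. Q (\<lambda>i. X i w) \<and> X k w = x) * pmf (p x) y)
      * entry_prob p V C S m y)"
    by (intro sum.cong refl, subst markov_history[OF Suc.prems(1)]) simp_all
  also have "\<dots> = \<P>(w in M. Q (\<lambda>i. X i w) \<and> X k w = x) * entry_prob p V C S (Suc m) x"
    unfolding entry_prob.simps sum_distrib_left by (simp add: mult_ac)
  finally show ?case .
qed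


text \<open>Disjointness of \<open>C\<close> and \<open>S\<close> makes the entry time unique, so
  the events for different \<open>m\<close> are disjoint and their probabilities add up. The second
  factor depends on neither \<open>k\<close> nor \<open>Q\<close>.\<close>

lemma emeasure_enters:
  assumes h: "history k Q" and x: "x \<in> V" and CS: "C \<inter> S = {}"
  shows "emeasure M {w \<in> space M. (Q (\<lambda>i. X i w) \<and> X k w = x) \<and> enters C S (\<lambda>i. X (k + i) w)}
    = emeasure M {w \<in> space M. Q (\<lambda>i. X i w) \<and> X k w = x}
      * (\<Sum>m. ennreal (entry_prob p V C S m x))"
proof -
  note [measurable] = pred_history[OF h]
  let ?E = "\<lambda>m. {w \<in> space M. (Q (\<lambda>i. X i w) \<and> X k w = x)
      \<and> (\<forall>i<m. X (k + i) w \<in> C) \<and> X (k + m) w \<in> S}"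
  have disj: "disjoint_family ?E"
    unfolding disjoint_family_on_def
  proof (intro ballI impI)
    fix m m' :: nat assume "m \<noteq> m'"
    then consider "m < m'" | "m' < m" by linarith
    then show "?E m \<inter> ?E m' = {}"
      using CS by cases blast+
  qed
  have "{w \<in> space M. (Q (\<lambda>i. X i w) \<and> X k w = x) \<and> enters C S (\<lambda>i. X (k + i) w)} = (\<Union>m. ?E m)"
    unfolding enters_def by blast
  also have "emeasure M (\<Union>m. ?E m) = (\<Sum>m. emeasure M (?E m))"
    by (rule suminf_emeasure[symmetric, OF _ disj]) auto
  also have "\<dots> = (\<Sum>m. emeasure M {w \<in> space M. Q (\<lambda>i. X i w) \<and> X k w = x}
      * ennreal (entry_prob p V C S m x))"
    unfolding emeasure_eq_measure prob_entry_at[OF h x] by (simp add: ennreal_mult')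
  finally show ?thesis by (simp add: ennreal_suminf_cmult)
qed

end

section \<open>Almost sure exit by the maximum principle\<close>

text \<open>The transition graph; its reflexive transitive closure allows a path into
  \<open>A\<close> to be continued by a path from \<open>A\<close> to \<open>B\<close>.\<close>

definition jumps :: "'s set \<Rightarrow> ('s \<Rightarrow> 's pmf) \<Rightarrow> ('s \<times> 's) set" where
  "jumps V p = {(x, y). x \<in> V \<and> y \<in> V \<and> pmf (p x) y > 0}"

lemma reachable_jumps:
  assumes "reachable V p A B S x"
  shows "\<exists>y\<in>S. (x, y) \<in> (jumps V p)\<^sup>*"
proof -
  obtain k z where z: "z 0 = x" "\<forall>l\<le>k. z l \<in> V" "z k \<in> S"
      "\<forall>l<k. pmf (p (z l)) (z (Suc l)) > 0"
    using assms unfolding reachable_def by blast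
  have "l \<le> k \<Longrightarrow> (x, z l) \<in> (jumps V p)\<^sup>*" for l
  proof (induction l)
    case 0
    then show ?case using z(1) by simp
  next
    case (Suc l)
    then have "(z l, z (Suc l)) \<in> jumps V p"
      using z by (simp add: jumps_def)
    then show ?case using Suc by (simp add: rtrancl_into_rtrancl)
  qed
  then show ?thesis using z(3) by blast
qed

text \<open>Maximum principle: a positive maximum can only be attained in \<open>C\<close>, and
  there it equals the average over the successors, so it spreads along jumps. It would thus reach a
  state outside \<open>C\<close>, where \<open>L\<close> is 0.\<close>

lemma harmonic_vanishes:
  fixes L :: "'s \<Rightarrow> real"
  assumes V: "finite V" and closed: "\<And>x. x \<in> V \<Longrightarrow> set_pmf (p x) \<subseteq> V"
    and harm: "\<And>x. x \<in> V \<Longrightarrow> L x = indicator C x * (\<Sum>y\<in>V. pmf (p x) y * L y)"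
    and exit: "\<And>x. x \<in> V \<Longrightarrow> \<exists>y\<in>V - C. (x, y) \<in> (jumps V p)\<^sup>*"
    and nonneg: "\<And>x. x \<in> V \<Longrightarrow> 0 \<le> L x" and x: "x \<in> V"
  shows "L x = 0"
proof (rule ccontr)
  assume "L x \<noteq> 0"
  define m where "m = Max (L ` V)"
  have le: "L y \<le> m" if "y \<in> V" for y
    using V that unfolding m_def by simp
  have m: "m > 0" using le[OF x] nonneg[OF x] \<open>L x \<noteq> 0\<close> by linarith
  have "m \<in> L ` V" unfolding m_def using V x by (intro Max_in) auto
  then obtain a where a: "a \<in> V" "L a = m" by auto
  obtain b where b: "b \<in> V - C" "(a, b) \<in> (jumps V p)\<^sup>*" using exit[OF a(1)] by blast
  from b(2) have "L b = m"
  proof (induction rule: rtrancl_induct)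
    case base
    show ?case by (rule a)
  next
    case (step u v)
    then have uv: "u \<in> V" "v \<in> V" "pmf (p u) v > 0" by (auto simp: jumps_def)
    have "u \<in> C" using harm[OF uv(1)] step.IH m by (cases "u \<in> C") simp_all
    then have "(\<Sum>y\<in>V. pmf (p u) y * L y) = m"
      using harm[OF uv(1)] step.IH by simp
    moreover have "(\<Sum>y\<in>V. pmf (p u) y * m) = m"
      using sum_pmf_eq_1[OF V closed[OF uv(1)]] by (simp flip: sum_distrib_right)
    \<comment> \<open>The summands are nonnegative, so each vanishes; positive jump probability then
      forces the value \<open>m\<close> at \<open>v\<close>.\<close>
    ultimately have "(\<Sum>y\<in>V. pmf (p u) y * (m - L y)) = 0"
      by (simp add: right_diff_distrib sum_subtractf)
    then have "\<forall>y\<in>V. pmf (p u) y * (m - L y) = 0"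
      using V le by (subst (asm) sum_nonneg_eq_0_iff) auto
    then show ?case using uv by auto
  qed
  moreover have "L b = 0" using harm[of b] b(1) by simp
  ultimately show False using m by simp
qed

lemma entry_prob_nonneg: "0 \<le> entry_prob p V C S m x"
  by (induction m arbitrary: x) (auto intro!: mult_nonneg_nonneg sum_nonneg)

text \<open>With both sets equal to \<open>C\<close>, \<open>entry_prob\<close> is the probability
  of staying in \<open>C\<close> through time \<open>m\<close>. It decreases in \<open>m\<close>,
  and its limit inherits the recursion as a harmonic equation, so the maximum principle
  applies.\<close>

lemma entry_prob_stay_tendsto_0:
  assumes V: "finite V" and closed: "\<And>x. x \<in> V \<Longrightarrow> set_pmf (p x) \<subseteq> V"
    and exit: "\<And>x. x \<in> V \<Longrightarrow> \<exists>y\<in>V - C. (x, y) \<in> (jumps V p)\<^sup>*" and x: "x \<in> V"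
  shows "(\<lambda>m. entry_prob p V C C m x) \<longlonglongrightarrow> 0"
proof -
  let ?h = "\<lambda>m x. entry_prob p V C C m x"
  have step: "?h (Suc m) x \<le> ?h m x" if "x \<in> V" for m x
    using that
  proof (induction m arbitrary: x)
    case 0
    have "(\<Sum>y\<in>V. pmf (p x) y * indicator C y) \<le> (\<Sum>y\<in>V. pmf (p x) y)"
      by (intro sum_mono) (simp add: indicator_def)
    then show ?case
      using sum_pmf_eq_1[OF V closed[OF 0]] by (auto simp: indicator_def)
  next
    case (Suc m)
    have "(\<Sum>y\<in>V. pmf (p x) y * ?h (Suc m) y) \<le> (\<Sum>y\<in>V. pmf (p x) y * ?h m y)"
      by (intro sum_mono mult_left_mono Suc.IH) auto
    then show ?case
      by (subst (1 2) entry_prob.simps) (intro mult_left_mono, auto)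
  qed
  define L where "L = (\<lambda>x. lim (\<lambda>m. ?h m x))"
  have lim: "(\<lambda>m. ?h m x) \<longlonglongrightarrow> L x" if "x \<in> V" for x
  proof -
    have "decseq (\<lambda>m. ?h m x)" by (intro decseq_SucI step that)
    then have "convergent (\<lambda>m. ?h m x)"
      using decseq_convergent[of "\<lambda>m. ?h m x" 0] entry_prob_nonneg
      unfolding convergent_def by metis
    then show ?thesis unfolding L_def by (simp add: convergent_LIMSEQ_iff)
  qed
  have "L x = 0"
  proof (rule harmonic_vanishes[OF V closed _ exit _ x])
    fix x assume x: "x \<in> V"
    have "(\<lambda>m. ?h (Suc m) x) \<longlonglongrightarrow> indicator C x * (\<Sum>y\<in>V. pmf (p x) y * L y)"
      unfolding entry_prob.simps by (intro tendsto_intros lim)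
    moreover have "(\<lambda>m. ?h (Suc m) x) \<longlonglongrightarrow> L x"
      using lim[OF x] by (rule LIMSEQ_Suc)
    ultimately show "L x = indicator C x * (\<Sum>y\<in>V. pmf (p x) y * L y)"
      using LIMSEQ_unique by blast
    show "0 \<le> L x"
      using lim[OF x] by (rule LIMSEQ_le_const) (auto intro: entry_prob_nonneg)
  qed
  then show ?thesis using lim[OF x] by simp
qed

text \<open>For each starting state, never leaving \<open>C\<close> is at most as likely as
  surviving through time \<open>m\<close>, for every \<open>m\<close>, and that probability tends to
  0. Finitely many starting states are then combined.\<close>

lemma (in finite_markov_chain) AE_exits:
  assumes closed: "\<And>x. x \<in> V \<Longrightarrow> set_pmf (p x) \<subseteq> V"
    and exit: "\<And>x. x \<in> V \<Longrightarrow> \<exists>y\<in>V - C. (x, y) \<in> (jumps V p)\<^sup>*"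
  shows "AE w in M. \<exists>m. X m w \<notin> C"
proof -
  have "AE w in M. X 0 w = x \<longrightarrow> (\<exists>m. X m w \<notin> C)" if x: "x \<in> V" for x
  proof -
    let ?E = "{w \<in> space M. X 0 w = x \<and> (\<forall>m. X m w \<in> C)}"
    have "measure M ?E \<le> entry_prob p V C C m x" for m
    proof -
      have "history 0 (\<lambda>_. True)" by (simp add: history_def)
      note eq = prob_entry_at[OF this x, of m C C]
      have "measure M ?E \<le> \<P>(w in M. (True \<and> X 0 w = x) \<and> (\<forall>i<m. X (0 + i) w \<in> C) \<and> X (0 + m) w \<in> C)"
        by (rule finite_measure_mono) auto
      also have "\<dots> \<le> entry_prob p V C C m x"
        unfolding eq by (rule mult_left_le_one_le) (auto simp: entry_prob_nonneg)
      finally show ?thesis .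
    qed
    then have "measure M ?E \<le> 0"
      using entry_prob_stay_tendsto_0[OF finite_V closed exit x]
      by (intro LIMSEQ_le_const) auto
    then have "measure M ?E = 0" using measure_nonneg[of M ?E] by linarith
    then have "?E \<in> null_sets M"
      by (intro null_setsI) (simp_all add: emeasure_eq_measure)
    then show ?thesis by (rule AE_I') auto
  qed
  then have "AE w in M. \<forall>x\<in>V. X 0 w = x \<longrightarrow> (\<exists>m. X m w \<notin> C)"
    by (intro AE_finite_allI finite_V) auto
  then show ?thesis
    by (rule AE_mp) (auto intro!: AE_I2 dest: state_in[of _ 0])
qed

section \<open>Hitting times along a single path\<close>

lemma le_hitting_time_iff: "enat l \<le> hitting_time S z \<longleftrightarrow> (\<forall>i<l. z i \<notin> S)"
  unfolding hitting_time_def le_INF_iff using not_less by auto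

lemma less_hitting_time_iff: "enat l < hitting_time S z \<longleftrightarrow> (\<forall>i\<le>l. z i \<notin> S)"
  using le_hitting_time_iff[of "Suc l" S z] by (simp add: Suc_ile_eq less_Suc_eq_le)

text \<open>Avoidance of \<open>B\<close> is required strictly before \<open>l\<close> only, so the
  visit at the hitting time itself is counted.\<close>

lemma visits_hitting_time:
  "visits 0 (hitting_time B z) x z = (\<Sum>l. of_bool ((\<forall>i<l. z i \<notin> B) \<and> z l = x))"
  unfolding visits_def le_hitting_time_iff by (intro suminf_cong) (auto simp: zero_enat_def)

lemma last_hit_eq: "last_hit A B z = Max {l. z l \<in> A \<and> (\<forall>i\<le>l. z i \<notin> B)}"
  unfolding last_hit_def less_hitting_time_iff ..

text \<open>The path leaves \<open>V - (A \<union> B)\<close>, and its first exit lands in exactly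
  one of the disjoint sets \<open>A\<close> and \<open>B\<close>.\<close>

lemma enters_complement:
  assumes "\<exists>m. z m \<notin> V - (A \<union> B)" and "\<And>i. z i \<in> V" and "A \<inter> B = {}"
  shows "enters (V - (A \<union> B)) A z \<longleftrightarrow> \<not> enters (V - (A \<union> B)) B z"
proof
  assume "enters (V - (A \<union> B)) A z"
  then obtain m where m: "\<forall>i<m. z i \<in> V - (A \<union> B)" "z m \<in> A" unfolding enters_def by blast
  show "\<not> enters (V - (A \<union> B)) B z"
  proof
    assume "enters (V - (A \<union> B)) B z"
    then obtain m' where m': "\<forall>i<m'. z i \<in> V - (A \<union> B)" "z m' \<in> B" unfolding enters_def by blast
    show False
      using m m' assms(3) by (cases m m' rule: linorder_cases) blast+
  qed
next
  assume nB: "\<not> enters (V - (A \<union> B)) B z"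
  define m where "m = (LEAST m. z m \<notin> V - (A \<union> B))"
  have "z m \<notin> V - (A \<union> B)" unfolding m_def using assms(1) by (rule LeastI_ex)
  moreover have "\<forall>i<m. z i \<in> V - (A \<union> B)"
    unfolding m_def using not_less_Least by blast
  ultimately show "enters (V - (A \<union> B)) A z"
    using nB assms(2)[of m] unfolding enters_def by blast
qed

lemma hitting_time_less_iff_enters:
  assumes "\<And>i. z i \<in> V" and "A \<inter> B = {}"
  shows "hitting_time B z < hitting_time A z \<longleftrightarrow> enters (V - (A \<union> B)) B z"
proof
  assume "hitting_time B z < hitting_time A z"
  then obtain k where "z k \<in> B" "enat k < hitting_time A z"
    unfolding hitting_time_def[of B] INF_less_iff by auto
  then have k: "z k \<in> B" "\<forall>i\<le>k. z i \<notin> A" by (simp_all add: less_hitting_time_iff)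
  \<comment> \<open>The first hit of \<open>B\<close> is the entry time: before it the path has met
    neither \<open>B\<close> nor, since \<open>m \<le> k\<close>, the set \<open>A\<close>.\<close>
  define m where "m = (LEAST m. z m \<in> B)"
  have "z m \<in> B" "m \<le> k" unfolding m_def using k by (auto intro: LeastI Least_le)
  moreover have "\<forall>i<m. z i \<notin> B" unfolding m_def using not_less_Least by blast
  ultimately show "enters (V - (A \<union> B)) B z"
    unfolding enters_def using k assms(1) by (intro exI[of _ m]) auto
next
  assume "enters (V - (A \<union> B)) B z"
  then obtain m where m: "\<forall>i<m. z i \<in> V - (A \<union> B)" "z m \<in> B" unfolding enters_def by blast
  then have "enat m < hitting_time A z"
    using assms(2) by (auto simp: less_hitting_time_iff order.order_iff_strict)
  then show "hitting_time B z < hitting_time A z"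
    unfolding hitting_time_def[of B] INF_less_iff using m(2) by blast
qed

section \<open>The last hitting time on a path from \<open>A\<close> that reaches
  \<open>B\<close>\<close>

context
  fixes V A B :: "'s set" and z :: "nat \<Rightarrow> 's"
  assumes AB: "A \<inter> B = {}" and V: "\<And>i. z i \<in> V" and start: "z 0 \<in> A" and hit: "\<exists>m. z m \<in> B"
begin

lemma finite_hits: "finite {l. z l \<in> A \<and> (\<forall>i\<le>l. z i \<notin> B)}"
proof -
  obtain m where "z m \<in> B" using hit by blast
  then have "{l. z l \<in> A \<and> (\<forall>i\<le>l. z i \<notin> B)} \<subseteq> {..m}" using nat_le_linear by blast
  then show ?thesis by (rule finite_subset) simp
qed

text \<open>Time 0 lies in the set because the path starts in \<open>A\<close>, which is disjoint
  from \<open>B\<close>; together with finiteness this makes \<open>Max\<close> an attained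
  value.\<close>

lemma last_hit_in: "z (last_hit A B z) \<in> A" "i \<le> last_hit A B z \<Longrightarrow> z i \<notin> B"
proof -
  have "0 \<in> {l. z l \<in> A \<and> (\<forall>i\<le>l. z i \<notin> B)}" using start AB by auto
  then have "last_hit A B z \<in> {l. z l \<in> A \<and> (\<forall>i\<le>l. z i \<notin> B)}"
    unfolding last_hit_eq using Max_in[OF finite_hits] by blast
  then show "z (last_hit A B z) \<in> A" "i \<le> last_hit A B z \<Longrightarrow> z i \<notin> B" by auto
qed

text \<open>If \<open>l\<close> is not past the last hit, the path from \<open>l\<close> still meets
  \<open>A\<close> before \<open>B\<close>. Conversely, such a meeting is a hit of \<open>A\<close>
  before \<open>B\<close> is reached, hence a lower bound for the maximum. The right-hand side
  separates past and future at time \<open>l\<close>.\<close>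

lemma le_last_hit_iff:
  "l \<le> last_hit A B z \<longleftrightarrow>
    (\<forall>i<l. z i \<notin> B) \<and> enters (V - (A \<union> B)) A (\<lambda>i. z (l + i))"
proof
  assume l: "l \<le> last_hit A B z"
  then obtain d where d: "last_hit A B z = l + d" using le_Suc_ex by blast
  define m where "m = (LEAST m. z (l + m) \<in> A)"
  have m: "z (l + m) \<in> A" "m \<le> d"
    unfolding m_def using last_hit_in(1) d by (auto intro: LeastI[of _ d] Least_le)
  have "\<forall>i<m. z (l + i) \<notin> A" unfolding m_def using not_less_Least by blast
  moreover have "\<forall>i<m. z (l + i) \<notin> B" using last_hit_in(2) d m(2) by simp
  ultimately have "enters (V - (A \<union> B)) A (\<lambda>i. z (l + i))"
    unfolding enters_def using m(1) V by blast
  then show "(\<forall>i<l. z i \<notin> B) \<and> enters (V - (A \<union> B)) A (\<lambda>i. z (l + i))"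
    using last_hit_in(2) l by simp
next
  assume "(\<forall>i<l. z i \<notin> B) \<and> enters (V - (A \<union> B)) A (\<lambda>i. z (l + i))"
  then obtain m where m: "\<forall>i<l. z i \<notin> B" "\<forall>i<m. z (l + i) \<in> V - (A \<union> B)" "z (l + m) \<in> A"
    unfolding enters_def by blast
  \<comment> \<open>\<open>B\<close> is avoided before \<open>l\<close>, on the stretch inside
    \<open>V - (A \<union> B)\<close>, and at the end point, which lies in \<open>A\<close>.\<close>
  have "z i \<notin> B" if i: "i \<le> l + m" for i
  proof -
    consider "i < l" | j where "i = l + j" "j < m" | "i = l + m"
    proof -
      consider "i < l" | "l \<le> i" "i < l + m" | "i = l + m" using i by linarith
      then show ?thesis
      proof cases
        case 2
        then have "i = l + (i - l)" "i - l < m" by linarith+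
        then show ?thesis using that(2) by blast
      qed (use that in blast)+
    qed
    then show ?thesis using m AB by cases auto
  qed
  then have "l + m \<le> last_hit A B z"
    unfolding last_hit_eq using m(3) by (intro Max_ge finite_hits) auto
  then show "l \<le> last_hit A B z" by simp
qed

lemma last_hit_less_iff:
  assumes "\<forall>i<l. z i \<notin> B"
  shows "last_hit A B z < l \<longleftrightarrow> enters (V - (A \<union> B)) B (\<lambda>i. z (l + i))"
proof -
  obtain m where m: "z m \<in> B" using hit by blast
  \<comment> \<open>The hit of \<open>B\<close> lies at or after \<open>l\<close>, so the shifted
    path leaves \<open>V - (A \<union> B)\<close> and the two entries are complementary.\<close>
  then have "l \<le> m" using assms by (meson not_le)
  then have "z (l + (m - l)) \<notin> V - (A \<union> B)" using m by simp
  then have "enters (V - (A \<union> B)) A (\<lambda>i. z (l + i)) \<longleftrightarrow> \<not> enters (V - (A \<union> B)) B (\<lambda>i. z (l + i))"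
    by (intro enters_complement V AB) blast
  then show ?thesis using le_last_hit_iff[of l] assms not_le[of l "last_hit A B z"] by blast
qed

lemma visits_last_hit:
  "visits 0 (enat (last_hit A B z)) x z = (\<Sum>l. of_bool (((\<forall>i<l. z i \<notin> B) \<and> z l = x)
    \<and> enters (V - (A \<union> B)) A (\<lambda>i. z (l + i))))"
  unfolding visits_def enat_ord_simps le_last_hit_iff
  by (intro suminf_cong) (auto simp: zero_enat_def)

text \<open>Entering \<open>B\<close> first characterises the times strictly after the last hit. The
  last hitting time itself is also counted and contributes the separate summand.\<close>

lemma visits_after_last_hit:
  "visits (enat (last_hit A B z)) (hitting_time B z) x z
    = (\<Sum>l. of_bool (((\<forall>i<l. z i \<notin> B) \<and> z l = x) \<and> enters (V - (A \<union> B)) B (\<lambda>i. z (l + i))))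
      + indicator {x} (z (last_hit A B z)) * indicator A x"
proof -
  let ?s = "last_hit A B z"
  have "visits (enat ?s) (hitting_time B z) x z
      = (\<Sum>l. of_bool (((\<forall>i<l. z i \<notin> B) \<and> z l = x) \<and> enters (V - (A \<union> B)) B (\<lambda>i. z (l + i)))
          + (if l = ?s then indicator {x} (z l) else 0))"
    unfolding visits_def
  proof (rule suminf_cong)
    fix l
    show "(if enat ?s \<le> enat l \<and> enat l \<le> hitting_time B z then indicator {x} (z l) else 0)
      = (of_bool (((\<forall>i<l. z i \<notin> B) \<and> z l = x) \<and> enters (V - (A \<union> B)) B (\<lambda>i. z (l + i)))
          + (if l = ?s then indicator {x} (z l) else 0) :: ennreal)"
    proof (cases "\<forall>i<l. z i \<notin> B")
      case True
      then show ?thesis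
        unfolding last_hit_less_iff[OF True, symmetric]
        by (auto simp: le_hitting_time_iff indicator_def)
    next
      case False
      \<comment> \<open>Here \<open>l\<close> is past the first hit of \<open>B\<close>, so every
        term is 0, the one for the last hit included.\<close>
      then have "l \<noteq> ?s" using last_hit_in(2) by force
      with False show ?thesis by (auto simp: le_hitting_time_iff)
    qed
  qed
  also have "\<dots> = (\<Sum>l. of_bool (((\<forall>i<l. z i \<notin> B) \<and> z l = x) \<and> enters (V - (A \<union> B)) B (\<lambda>i. z (l + i))))
      + (\<Sum>l. if l = ?s then indicator {x} (z l) else 0)"
    by (rule suminf_add[symmetric]) auto
  also have "(\<Sum>l. if l = ?s then indicator {x} (z l) else 0) = (indicator {x} (z ?s) :: ennreal)"
    using sums_single[of ?s "\<lambda>l. indicator {x} (z l) :: ennreal"] by (simp add: sums_iff)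
  also have "\<dots> = indicator {x} (z ?s) * indicator A x"
    using last_hit_in(1) by (auto simp: indicator_def)
  finally show ?thesis .
qed

end

section \<open>Expectations and the committor\<close>

context finite_markov_chain
begin

lemma measurable_last_hit [measurable]:
  "(\<lambda>w. last_hit A B (\<lambda>k. X k w)) \<in> M \<rightarrow>\<^sub>M count_space UNIV"
  unfolding last_hit_eq by measurable

lemma pred_at_last_hit [measurable]:
  "Measurable.pred M (\<lambda>w. X (last_hit A B (\<lambda>k. X k w)) w \<in> S)"
proof -
  \<comment> \<open>The state at a random time is handled by a countable union over the values of
    that time.\<close>
  have "Measurable.pred M (\<lambda>w. \<exists>l. last_hit A B (\<lambda>k. X k w) = l \<and> X l w \<in> S)"
    by measurable
  then show ?thesis by simp
qed

lemma nn_integral_suminf_of_bool: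
  assumes [measurable]: "\<And>l. Measurable.pred M (R l)"
  shows "(\<integral>\<^sup>+ w. (\<Sum>l. of_bool (R l w)) \<partial>M) = (\<Sum>l::nat. emeasure M {w \<in> space M. R l w})"
proof -
  have ind: "of_bool (R l w) = (indicator {w \<in> space M. R l w} w :: ennreal)" if "w \<in> space M" for l w
    using that by simp
  have "(\<integral>\<^sup>+ w. (\<Sum>l. of_bool (R l w)) \<partial>M)
      = (\<integral>\<^sup>+ w. (\<Sum>l. indicator {w \<in> space M. R l w} w) \<partial>M)"
    by (intro nn_integral_cong suminf_cong ind)
  also have "\<dots> = (\<Sum>l. emeasure M {w \<in> space M. R l w})"
    by (subst nn_integral_suminf) auto
  finally show ?thesis .
qed

lemma AE_start:
  assumes "set_pmf \<nu> \<subseteq> A"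
  shows "AE w in M. X 0 w \<in> A"
proof -
  have "AE w in M. X 0 w \<noteq> x" if "x \<in> V - A" for x
  proof -
    have "\<P>(w in M. X 0 w = x) = 0"
      using initial[of x] that assms by (auto simp: set_pmf_iff)
    then have "{w \<in> space M. X 0 w = x} \<in> null_sets M"
      by (intro null_setsI) (simp_all add: emeasure_eq_measure)
    then show ?thesis by (rule AE_I') auto
  qed
  then have "AE w in M. \<forall>x\<in>V - A. X 0 w \<noteq> x"
    by (intro AE_finite_allI) (auto simp: finite_V)
  then show ?thesis
    by (rule AE_mp) (auto intro!: AE_I2 dest: state_in[of _ 0])
qed

lemma enters_from_point:
  assumes x: "x \<in> V" and \<nu>: "\<nu> = return_pmf x" and "C \<inter> S = {}"
  shows "emeasure M {w \<in> space M. enters C S (\<lambda>i. X i w)} = (\<Sum>m. ennreal (entry_prob p V C S m x))"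
proof -
  have h: "history 0 (\<lambda>_. True)" by (simp add: history_def)
  have P: "\<P>(w in M. X 0 w = x) = 1" using initial[OF x] \<nu> by simp
  then have AE: "AE w in M. X 0 w = x" by (subst (asm) prob_Collect_eq_1) auto
  have "emeasure M {w \<in> space M. enters C S (\<lambda>i. X i w)}
      = emeasure M {w \<in> space M. (True \<and> X 0 w = x) \<and> enters C S (\<lambda>i. X (0 + i) w)}"
    using pred_enters[of C S 0] by (intro emeasure_eq_AE) (use AE in auto)
  also have "\<dots> = (\<Sum>m. ennreal (entry_prob p V C S m x))"
    unfolding emeasure_enters[OF h x assms(3)] using P by (simp add: emeasure_eq_measure)
  finally show ?thesis .
qed

text \<open>\<open>entry_prob\<close> is determined by \<open>p\<close>, \<open>V\<close> and the
  sets alone, so the series can be evaluated on a chain started at \<open>x\<close> and then used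
  for any other initial law. Almost sure exit makes the entries into \<open>A\<close> and
  \<open>B\<close> complementary.\<close>

lemma committor_entry:
  assumes x: "x \<in> V" and \<nu>: "\<nu> = return_pmf x" and AB: "A \<inter> B = {}"
    and exits: "AE w in M. \<exists>m. X m w \<notin> V - (A \<union> B)"
  shows "(\<Sum>m. ennreal (entry_prob p V (V - (A \<union> B)) B m x)) = ennreal (committor M X A B)"
    and "(\<Sum>m. ennreal (entry_prob p V (V - (A \<union> B)) A m x)) = ennreal (1 - committor M X A B)"
proof -
  let ?C = "V - (A \<union> B)"
  have [measurable]: "Measurable.pred M (\<lambda>w. enters ?C S (\<lambda>i. X i w))" for S
    using pred_enters[of ?C S 0] by simp
  have C: "?C \<inter> A = {}" "?C \<inter> B = {}" by auto
  have q: "committor M X A B = \<P>(w in M. enters ?C B (\<lambda>i. X i w))"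
    unfolding committor_def
    by (intro arg_cong[where f = "measure M"] Collect_cong conj_cong refl
        hitting_time_less_iff_enters state_in AB)
  show "(\<Sum>m. ennreal (entry_prob p V ?C B m x)) = ennreal (committor M X A B)"
    unfolding q using enters_from_point[OF x \<nu> C(2)] by (simp add: emeasure_eq_measure)
  have "AE w in M. enters ?C A (\<lambda>i. X i w) \<longleftrightarrow> \<not> enters ?C B (\<lambda>i. X i w)"
    using exits by (rule AE_mp) (intro AE_I2 impI enters_complement state_in AB)
  then have "\<P>(w in M. enters ?C A (\<lambda>i. X i w)) = \<P>(w in M. \<not> enters ?C B (\<lambda>i. X i w))"
    by (intro finite_measure_eq_AE) auto
  also have "\<dots> = 1 - committor M X A B"
    unfolding q by (rule prob_neg) simp
  finally show "(\<Sum>m. ennreal (entry_prob p V ?C A m x)) = ennreal (1 - committor M X A B)"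
    using enters_from_point[OF x \<nu> C(1)] by (simp add: emeasure_eq_measure)
qed

context
  fixes A B :: "'s set" and x :: 's
  assumes AB: "A \<inter> B = {}" and x: "x \<in> V"
    and good: "AE w in M. X 0 w \<in> A \<and> (\<exists>m. X m w \<in> B)"
begin

lemma history_avoid: "history l (\<lambda>z. \<forall>i<l. z i \<notin> B)"
  unfolding history_def by auto

lemma theta_eq:
  "theta M X B x = (\<Sum>l. emeasure M {w \<in> space M. (\<forall>i<l. X i w \<notin> B) \<and> X l w = x})"
  unfolding theta_def visits_hitting_time by (rule nn_integral_suminf_of_bool) measurable

text \<open>For each \<open>l\<close>, the visit to \<open>x\<close> is an event of the past and the
  entry one of the future. The Markov property gives a factor independent of \<open>l\<close>, and
  the remaining series is \<open>theta\<close>.\<close>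

lemma nn_integral_visits_then_enters:
  assumes "(V - (A \<union> B)) \<inter> S = {}"
  shows "(\<integral>\<^sup>+ w. (\<Sum>l. of_bool (((\<forall>i<l. X i w \<notin> B) \<and> X l w = x)
      \<and> enters (V - (A \<union> B)) S (\<lambda>i. X (l + i) w))) \<partial>M)
    = theta M X B x * (\<Sum>m. ennreal (entry_prob p V (V - (A \<union> B)) S m x))"
proof -
  have "(\<integral>\<^sup>+ w. (\<Sum>l. of_bool (((\<forall>i<l. X i w \<notin> B) \<and> X l w = x)
        \<and> enters (V - (A \<union> B)) S (\<lambda>i. X (l + i) w))) \<partial>M)
      = (\<Sum>l. emeasure M {w \<in> space M. ((\<forall>i<l. X i w \<notin> B) \<and> X l w = x)
        \<and> enters (V - (A \<union> B)) S (\<lambda>i. X (l + i) w)})"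
    by (rule nn_integral_suminf_of_bool) measurable
  also have "\<dots> = (\<Sum>l. emeasure M {w \<in> space M. (\<forall>i<l. X i w \<notin> B) \<and> X l w = x}
      * (\<Sum>m. ennreal (entry_prob p V (V - (A \<union> B)) S m x)))"
    by (rule suminf_cong) (rule emeasure_enters[OF history_avoid x assms])
  finally show ?thesis unfolding theta_eq by (simp only: ennreal_suminf_multc)
qed

lemma theta_bar_eq:
  "theta_bar M X A B x
    = theta M X B x * (\<Sum>m. ennreal (entry_prob p V (V - (A \<union> B)) A m x))"
proof -
  have "theta_bar M X A B x = (\<integral>\<^sup>+ w. (\<Sum>l. of_bool (((\<forall>i<l. X i w \<notin> B) \<and> X l w = x)
      \<and> enters (V - (A \<union> B)) A (\<lambda>i. X (l + i) w))) \<partial>M)"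
    unfolding theta_bar_def
    by (rule nn_integral_cong_AE, rule AE_mp[OF good], rule AE_I2, rule impI,
        rule visits_last_hit[OF AB state_in]) blast+
  then show ?thesis by (subst (asm) nn_integral_visits_then_enters) auto
qed

lemma theta_tilde_eq:
  "theta_tilde M X A B x
    = theta M X B x * (\<Sum>m. ennreal (entry_prob p V (V - (A \<union> B)) B m x))
      + mu_r M X A B x * indicator A x"
proof -
  have meas [measurable]: "(\<lambda>w. indicator {x} (X (last_hit A B (\<lambda>k. X k w)) w) :: ennreal)
      \<in> borel_measurable M"
  proof -
    have "(\<lambda>w. if X (last_hit A B (\<lambda>k. X k w)) w \<in> {x} then 1 else 0 :: ennreal) \<in> borel_measurable M"
      by (intro measurable_If pred_at_last_hit[unfolded pred_def] measurable_const) simp_all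
    then show ?thesis by (simp only: indicator_def of_bool_def)
  qed
  have C: "(V - (A \<union> B)) \<inter> B = {}" by blast
  have "theta_tilde M X A B x = (\<integral>\<^sup>+ w. (\<Sum>l. of_bool (((\<forall>i<l. X i w \<notin> B) \<and> X l w = x)
        \<and> enters (V - (A \<union> B)) B (\<lambda>i. X (l + i) w)))
      + indicator {x} (X (last_hit A B (\<lambda>k. X k w)) w) * indicator A x \<partial>M)"
    unfolding theta_tilde_def
    by (rule nn_integral_cong_AE, rule AE_mp[OF good], rule AE_I2, rule impI,
        rule visits_after_last_hit[OF AB state_in]) blast+
  also have "\<dots> = (\<integral>\<^sup>+ w. (\<Sum>l. of_bool (((\<forall>i<l. X i w \<notin> B) \<and> X l w = x)
        \<and> enters (V - (A \<union> B)) B (\<lambda>i. X (l + i) w))) \<partial>M) + mu_r M X A B x * indicator A x"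
    unfolding mu_r_def by (subst nn_integral_add) (measurable, simp only: nn_integral_multc[OF meas])
  finally show ?thesis unfolding nn_integral_visits_then_enters[OF C] .
qed

end

end

section \<open>Reaching \<open>B\<close> from every state and the two identities\<close>

theorem proposition7:
  fixes n :: nat and V A B :: "nat set"
    and p :: "nat \<Rightarrow> nat pmf" and \<mu> :: "nat pmf"
    and M :: "'w measure" and X :: "nat \<Rightarrow> 'w \<Rightarrow> nat"
    and N :: "nat \<Rightarrow> 'v measure" and Y :: "nat \<Rightarrow> nat \<Rightarrow> 'v \<Rightarrow> nat"
    and q :: "nat \<Rightarrow> real"
  assumes "n > 1" and "V = {1..n}"
    and "\<And>x. x \<in> V \<Longrightarrow> set_pmf (p x) \<subseteq> V"
    and "A \<subseteq> V" and "B \<subseteq> V" and "A \<inter> B = {}" and "A \<noteq> {}" and "B \<noteq> {}"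
    and "set_pmf \<mu> \<subseteq> A"
    and "V - (A \<union> B) \<noteq> {}"
    and "\<And>x. x \<in> V - (A \<union> B) \<Longrightarrow> reachable V p A B A x \<or> reachable V p A B B x"
    and "\<And>x. x \<in> A \<Longrightarrow> reachable V p A B B x"
    and "markov_chain V p \<mu> M X"
    and "\<And>x. x \<in> V \<Longrightarrow> markov_chain V p (return_pmf x) (N x) (Y x)"
    and "\<And>x. x \<in> V \<Longrightarrow> q x = committor (N x) (Y x) A B"
  shows "\<forall>x\<in>V.
      theta_bar M X A B x = theta M X B x * ennreal (1 - q x) \<and>
      theta_tilde M X A B x = theta M X B x * ennreal (q x) + mu_r M X A B x * indicator A x"
proof
  fix x assume x: "x \<in> V"
  have fin: "finite V" using assms(2) by simp
  note closed = assms(3) and AB = assms(6)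
  interpret chain: finite_markov_chain V p \<mu> M X
    by (rule finite_markov_chain.intro[OF assms(13) finite_markov_chain_axioms.intro[OF fin]])
  interpret point: finite_markov_chain V p "return_pmf x" "N x" "Y x"
    by (rule finite_markov_chain.intro[OF assms(14)[OF x] finite_markov_chain_axioms.intro[OF fin]])
  have fromA: "\<exists>b\<in>B. (y, b) \<in> (jumps V p)\<^sup>*" if "y \<in> A" for y
    by (rule reachable_jumps[OF assms(12)[OF that]])
  have toB: "\<exists>b\<in>B. (y, b) \<in> (jumps V p)\<^sup>*" if y: "y \<in> V" for y
  proof -
    consider "y \<in> B" | "y \<in> A" | "y \<in> V - (A \<union> B)" using y by blast
    then show ?thesis
    proof cases
      case 1
      then show ?thesis by (intro bexI[of _ y]) simp_all
    next
      case 2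
      then show ?thesis by (rule fromA)
    next
      case 3
      from assms(11)[OF 3] show ?thesis
      proof
        assume "reachable V p A B A y"
        then obtain a where a: "a \<in> A" "(y, a) \<in> (jumps V p)\<^sup>*"
          by (rule reachable_jumps[THEN bexE])
        \<comment> \<open>A path into \<open>A\<close> is prolonged by one from its end point to
          \<open>B\<close>.\<close>
        obtain b where b: "b \<in> B" "(a, b) \<in> (jumps V p)\<^sup>*"
          by (rule bexE[OF fromA[OF a(1)]])
        from rtrancl_trans[OF a(2) b(2)] b(1) show ?thesis by (rule bexI)
      qed (rule reachable_jumps)
    qed
  qed
  \<comment> \<open>Used twice: with \<open>C = V - B\<close>, so that the chain started from
    \<open>\<mu>\<close> reaches \<open>B\<close>, and with \<open>C = V - (A \<union> B)\<close>,
    so that the chain started at \<open>x\<close> reaches \<open>A\<close> or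
    \<open>B\<close>.\<close>
  have exit: "\<exists>b\<in>V - C. (y, b) \<in> (jumps V p)\<^sup>*" if sub: "B \<subseteq> V - C" and y: "y \<in> V" for C y
  proof -
    obtain b where "b \<in> B" "(y, b) \<in> (jumps V p)\<^sup>*" by (rule bexE[OF toB[OF y]])
    with sub show ?thesis by (intro bexI[of _ b]) auto
  qed
  have avoid: "B \<subseteq> V - (V - B)" "B \<subseteq> V - (V - (A \<union> B))" using assms(5) by auto
  have "AE w in M. \<exists>m. X m w \<notin> V - B"
    by (rule chain.AE_exits[OF closed exit[OF avoid(1)]])
  with chain.AE_start[OF assms(9)]
  have good: "AE w in M. X 0 w \<in> A \<and> (\<exists>m. X m w \<in> B)"
    by (rule AE_mp[OF AE_conjI], intro AE_I2 impI) (use chain.state_in in blast)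
  have "AE w in N x. \<exists>m. Y x m w \<notin> V - (A \<union> B)"
    by (rule point.AE_exits[OF closed exit[OF avoid(2)]])
  \<comment> \<open>The two series, evaluated on the chain started at \<open>x\<close>, become
    \<open>q x\<close> and \<open>1 - q x\<close>; the same series occur as factors for the chain
    started from \<open>\<mu>\<close>.\<close>
  note q = point.committor_entry[OF x refl AB this, folded assms(15)[OF x]]
  show "theta_bar M X A B x = theta M X B x * ennreal (1 - q x) \<and>
      theta_tilde M X A B x = theta M X B x * ennreal (q x) + mu_r M X A B x * indicator A x"
    using chain.theta_bar_eq[OF AB x good] chain.theta_tilde_eq[OF AB x good] q by (simp only:)
qed

end
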